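(* There exists an absolute constant $C>0$ such that for all integers $b\ge 1$ and $s\ge 2$ there exists an ordered graph with at most $s\,e^{C\log b\,\sqrt{\log s}}$ edges for which every $b$-coloring of the vertices contains a monochromatic ordered path of length $s$.
   Context: An ordered graph on $n$ vertices is a finite simple graph whose vertices are labeled $1,2,\ldots,n$ (equivalently, a finite simple graph with a linear order on its vertices). An ordered path of length $s$ in an ordered graph is a monotone increasing path with $s$ edges, i.e. vertices $v_0<v_1<\cdots<v_s$ such that $v_{i-1}v_i$ is an edge for every $1\le i\le s$. A $b$-coloring of the vertices is an arbitrary (not necessarily proper) assignment of one of $b$ colors to each vertex; an ordered path is monochromatic if all of its vertices have the same color. $\log$ is the natural logarithm. *)

theory Defs
  imports Complex_Main "HOL-Library.FuncSet"
begin

definition ordered_graph :: "nat \<Rightarrow> nat set set \<Rightarrow> bool" where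
  "ordered_graph n E \<longleftrightarrow> E \<subseteq> {e. e \<subseteq> {1..n} \<and> card e = 2}"

text \<open>The path is given by the list of its \<open>s + 1\<close> vertices, and its length is the number \<open>s\<close>
  of its edges.\<close>

definition ordered_path :: "nat \<Rightarrow> nat set set \<Rightarrow> nat \<Rightarrow> nat list \<Rightarrow> bool" where
  "ordered_path n E s p \<longleftrightarrow>
     length p = s + 1 \<and> set p \<subseteq> {1..n} \<and> sorted_wrt (<) p \<and>
     (\<forall>i\<in>{1..s}. {p ! (i - 1), p ! i} \<in> E)"

definition vertex_coloring :: "nat \<Rightarrow> nat \<Rightarrow> (nat \<Rightarrow> nat) \<Rightarrow> bool" where
  "vertex_coloring n b c \<longleftrightarrow> c \<in> {1..n} \<rightarrow> {1..b}"

definition monochromatic :: "(nat \<Rightarrow> nat) \<Rightarrow> nat list \<Rightarrow> bool" where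
  "monochromatic c p \<longleftrightarrow> (\<forall>u\<in>set p. \<forall>v\<in>set p. c u = c v)"

end

theory Submission
  imports Defs
begin

text \<open>The graph is depth robust in the sense of Erdos, Graham and Szemeredi: two consecutive copies of
  the graph on \<open>2 ^ h\<close> vertices are joined by a sparse bipartite expander, in which any two sets of
  relative density at least \<open>1 / q\<close> are connected by an edge. By induction on \<open>h\<close>, every vertex set \<open>T\<close>
  contains an increasing path on at least \<open>card T - (h / q) * 2 ^ h\<close> vertices. Applied to
  the largest of \<open>b\<close> color classes with \<open>q = 2 * b * h\<close>, this leaves a monochromatic path on at least
  \<open>2 ^ h / (2 * b)\<close> vertices. The number of edges is \<open>s\<close> times a polynomial in \<open>b\<close> and \<open>log s\<close>.\<close>

section \<open>Sparse bipartite expanders from greedy hitting sets\<close>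

text \<open>Averaging: each set of \<open>F\<close> fills a proportion \<open>p\<close> of
  \<open>U\<close>, so some point of \<open>U\<close> lies in a proportion \<open>p\<close> of the
  sets not yet hit. Adding it to \<open>H\<close> multiplies the number of missed sets by at most
  \<open>1 - p\<close>.\<close>

lemma greedy_hitting_set:
  fixes p :: real
  assumes U: "finite U" "U \<noteq> {}" and F: "finite F" and p: "0 \<le> p" "p \<le> 1"
    and large: "\<And>A. A \<in> F \<Longrightarrow> A \<subseteq> U \<and> p * real (card U) \<le> real (card A)"
  shows "\<exists>H\<subseteq>U. card H \<le> t \<and> real (card {A\<in>F. A \<inter> H = {}}) \<le> (1 - p) ^ t * real (card F)"
proof (induction t)
  case 0
  show ?case by (intro exI[of _ "{}"]) auto
next
  case (Suc t)
  then obtain H where H: "H \<subseteq> U" "card H \<le> t"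
    and le: "real (card {A\<in>F. A \<inter> H = {}}) \<le> (1 - p) ^ t * real (card F)" by blast
  let ?M = "{A\<in>F. A \<inter> H = {}}"
  have finM: "finite ?M" using F by simp
  \<comment> \<open>Double count the pairs of a point \<open>u\<close> and an unhit set containing
    it: \<open>u\<close> ranges over \<open>U\<close> on one side, and each unhit set contributes at
    least \<open>p * card U\<close> on the other.\<close>
  have "\<exists>u\<in>U. p * real (card ?M) \<le> real (card {A\<in>?M. u \<in> A})"
  proof (rule ccontr)
    assume "\<not> ?thesis"
    then have "(\<Sum>u\<in>U. real (card {A\<in>?M. u \<in> A})) < (\<Sum>u\<in>U. p * real (card ?M))"
      using U by (intro sum_strict_mono) auto
    also have "\<dots> = (\<Sum>A\<in>?M. p * real (card U))" by simp
    also have "\<dots> \<le> (\<Sum>A\<in>?M. real (card {u\<in>U. u \<in> A}))"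
    proof (rule sum_mono)
      fix A assume "A \<in> ?M"
      then have "A \<subseteq> U" "p * real (card U) \<le> real (card A)" using large by auto
      moreover from this have "{u\<in>U. u \<in> A} = A" by blast
      ultimately show "p * real (card U) \<le> real (card {u\<in>U. u \<in> A})" by simp
    qed
    also have "\<dots> = (\<Sum>u\<in>U. real (card {A\<in>?M. u \<in> A}))"
      using sum_multicount_gen[OF U(1) finM, of "\<lambda>u A. u \<in> A" "\<lambda>A. card {u\<in>U. u \<in> A}"]
      by (simp flip: of_nat_sum)
    finally show False by simp
  qed
  then obtain u where u: "u \<in> U" "p * real (card ?M) \<le> real (card {A\<in>?M. u \<in> A})" by blast
  let ?N = "{A\<in>?M. u \<in> A}"
  have N: "?N \<subseteq> ?M" by blast
  have "{A\<in>F. A \<inter> insert u H = {}} = ?M - ?N" by blast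
  then have "real (card {A\<in>F. A \<inter> insert u H = {}}) = real (card ?M) - real (card ?N)"
    using card_Diff_subset[OF finite_subset[OF N finM] N] card_mono[OF finM N] by (simp only: of_nat_diff)
  also have "\<dots> \<le> (1 - p) * real (card ?M)" using u(2) by (simp add: algebra_simps)
  also have "\<dots> \<le> (1 - p) * ((1 - p) ^ t * real (card F))"
    using le p by (intro mult_left_mono) auto
  finally have "real (card {A\<in>F. A \<inter> insert u H = {}}) \<le> (1 - p) ^ Suc t * real (card F)" by simp
  moreover have "card (insert u H) \<le> Suc t" using H(2) card_insert_le_m1[of "Suc t" H u] by simp
  ultimately show ?case using u(1) H(1) by (intro exI[of _ "insert u H"]) auto
qed

text \<open>\<open>F\<close> is a hitting set for the rectangles with sides of relative density at
  least \<open>1 / q\<close>. There are at most \<open>4 ^ m\<close> of them, each of density at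
  least \<open>1 / q\<^sup>2\<close> in the product, so the greedy choice replaces the usual random
  graph.\<close>

lemma sparse_bipartite_expander:
  fixes A :: "'a set" and B :: "'b set"
  assumes A: "finite A" "card A = m" and B: "finite B" "card B = m" and "m > 0" "q > 0"
  shows "\<exists>F\<subseteq>A \<times> B. card F \<le> 2 * m * q\<^sup>2 \<and>
    (\<forall>X Y. X \<subseteq> A \<longrightarrow> Y \<subseteq> B \<longrightarrow> m \<le> q * card X \<longrightarrow> m \<le> q * card Y \<longrightarrow> (X \<times> Y) \<inter> F \<noteq> {})"
proof -
  define P where "P = {(X, Y). X \<subseteq> A \<and> Y \<subseteq> B \<and> m \<le> q * card X \<and> m \<le> q * card Y}"
  define G where "G = (\<lambda>(X, Y). X \<times> Y) ` P"
  have Psub: "P \<subseteq> Pow A \<times> Pow B" by (auto simp: P_def)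
  have finP: "finite P" using Psub A B by (meson finite_Pow_iff finite_SigmaI finite_subset)
  have finG: "finite G" using finP by (simp add: G_def)
  have "card G \<le> card P" unfolding G_def using finP by (rule card_image_le)
  also have "\<dots> \<le> card (Pow A \<times> Pow B)" using Psub A B by (intro card_mono) auto
  also have "\<dots> = 2 ^ m * 2 ^ m" using A B by (simp add: card_cartesian_product card_Pow)
  also have "\<dots> = 4 ^ m" by (simp flip: power_mult_distrib)
  finally have cardG: "real (card G) \<le> 4 ^ m"
    by (metis of_nat_le_iff of_nat_numeral of_nat_power)
  let ?p = "1 / (real q)\<^sup>2"
  have q1: "real q \<ge> 1" using \<open>q > 0\<close> by simp
  have p01: "0 \<le> ?p" "?p \<le> 1" using q1 by (auto simp: divide_le_eq)
  have large: "D \<subseteq> A \<times> B \<and> ?p * real (card (A \<times> B)) \<le> real (card D)" if "D \<in> G" for D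
  proof -
    obtain X Y where D: "D = X \<times> Y" and XY: "X \<subseteq> A" "Y \<subseteq> B" "m \<le> q * card X" "m \<le> q * card Y"
      using \<open>D \<in> G\<close> by (auto simp: G_def P_def)
    have "m * m \<le> (q * card X) * (q * card Y)" using XY by (intro mult_mono) auto
    then have "real m * real m \<le> (real q * real (card X)) * (real q * real (card Y))"
      by (metis of_nat_le_iff of_nat_mult)
    then show ?thesis using D XY A B q1
      by (auto simp: card_cartesian_product divide_le_eq power2_eq_square algebra_simps)
  qed
  obtain F where F: "F \<subseteq> A \<times> B" "card F \<le> 2 * m * q\<^sup>2"
    and le: "real (card {D\<in>G. D \<inter> F = {}}) \<le> (1 - ?p) ^ (2 * m * q\<^sup>2) * real (card G)"
    using greedy_hitting_set[OF _ _ finG p01 large, of "2 * m * q\<^sup>2"] A B \<open>m > 0\<close> by fastforce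
  have "(1 - ?p) ^ (2 * m * q\<^sup>2) \<le> exp (- ?p) ^ (2 * m * q\<^sup>2)"
    using p01 exp_ge_add_one_self[of "- ?p"] by (intro power_mono) auto
  also have "\<dots> = exp (- 2 * real m)"
    using q1 by (simp add: field_simps flip: exp_of_nat_mult)
  finally have "(1 - ?p) ^ (2 * m * q\<^sup>2) * real (card G) \<le> exp (- 2 * real m) * 4 ^ m"
    using cardG by (intro mult_mono) auto
  also have "\<dots> = (4 * exp (- 2)) ^ m"
    by (simp add: power_mult_distrib mult.commute flip: exp_of_nat_mult)
  \<comment> \<open>The factor 2 in \<open>2 * m * q\<^sup>2\<close> is what makes
    \<open>exp 2 > 4\<close> beat the number of rectangles; fewer than one missed rectangle means
    none.\<close>
  also have "\<dots> < 1"
  proof -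
    have "(2::real) * 2 < exp 1 * exp 1"
      using exp_lower_Taylor_quadratic[of "1::real"] by (intro mult_strict_mono) auto
    then have "4 * exp (- 2) < (1::real)"
      by (simp add: exp_minus field_simps flip: exp_add)
    then show ?thesis using \<open>m > 0\<close> by (subst power_less_one_iff) auto
  qed
  finally have "card {D\<in>G. D \<inter> F = {}} = 0" using le by linarith
  then have "D \<inter> F \<noteq> {}" if "D \<in> G" for D using that finG by auto
  then have "(X \<times> Y) \<inter> F \<noteq> {}" if "(X, Y) \<in> P" for X Y
    using that unfolding G_def by force
  then show ?thesis using F unfolding P_def by blast
qed

section \<open>Depth-robust graphs by doubling\<close>

text \<open>The loss is \<open>d / q\<close> vertices, multiplied out by \<open>q\<close> to stay
  within the naturals. Here \<open>length p\<close> counts vertices, and the empty list is an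
  admissible path.\<close>

definition path_defect :: "nat \<Rightarrow> nat \<Rightarrow> 'a set \<Rightarrow> ('a \<times> 'a) set \<Rightarrow> bool" where
  "path_defect q d V E \<longleftrightarrow> (\<forall>T\<subseteq>V. \<exists>p. set p \<subseteq> T \<and> successively (\<lambda>u v. (u, v) \<in> E) p \<and>
     q * card T \<le> q * length p + d)"

text \<open>Each half loses \<open>d\<close> on its own path, and joining the two paths across
  \<open>F\<close> costs at most a further \<open>m\<close> per half.\<close>

lemma path_defect_join:
  assumes A: "finite A" and B: "finite B" and "A \<inter> B = {}" and "m > 0"
    and E1: "path_defect q d A E1" and E2: "path_defect q d B E2"
    and F: "\<And>X Y. X \<subseteq> A \<Longrightarrow> Y \<subseteq> B \<Longrightarrow> m \<le> q * card X \<Longrightarrow> m \<le> q * card Y \<Longrightarrow> (X \<times> Y) \<inter> F \<noteq> {}"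
  shows "path_defect q (2 * d + 2 * m) (A \<union> B) (E1 \<union> E2 \<union> F)"
  unfolding path_defect_def
proof (intro allI impI)
  fix T assume T: "T \<subseteq> A \<union> B"
  let ?E = "E1 \<union> E2 \<union> F"
  let ?path = "\<lambda>E p. successively (\<lambda>u v. (u, v) \<in> E) p"
  define T1 where "T1 = T \<inter> A"
  define T2 where "T2 = T \<inter> B"
  have fin: "finite T1" "finite T2" using A B by (auto simp: T1_def T2_def)
  have "T = T1 \<union> T2" "T1 \<inter> T2 = {}" using T \<open>A \<inter> B = {}\<close> by (auto simp: T1_def T2_def)
  then have cardT: "q * card T = q * card T1 + q * card T2"
    using fin by (simp add: card_Un_disjoint distrib_left)
  have lift1: "?path ?E p" if "?path E1 p" for p using that by (rule successively_mono) auto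
  have lift2: "?path ?E p" if "?path E2 p" for p using that by (rule successively_mono) auto
  \<comment> \<open>\<open>Z\<close> collects the ends of long paths. If it is small, deleting it from \<open>T1\<close> destroys all long paths,
    which is only possible if \<open>T1\<close> itself is negligible. Otherwise the expander lets all but few
    vertices of \<open>T2\<close> continue a long path.\<close>
  define Z where "Z = {v\<in>T1. \<exists>p. p \<noteq> [] \<and> last p = v \<and> set p \<subseteq> T1 \<and> ?path E1 p \<and>
    q * card T1 \<le> q * length p + d + m}"
  have Z: "Z \<subseteq> T1" "finite Z" using fin by (auto simp: Z_def)
  show "\<exists>p. set p \<subseteq> T \<and> ?path ?E p \<and> q * card T \<le> q * length p + (2 * d + 2 * m)"
  proof (cases "m \<le> q * card Z")
    case True
    \<comment> \<open>Vertices of \<open>T2\<close> that no end of a long path reaches. Since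
      \<open>Z\<close> is large, the expander forces \<open>Y\<close> to be small, and a path
      avoiding \<open>Y\<close> can be attached to a long path whatever its first vertex.\<close>
    define Y where "Y = {y\<in>T2. \<forall>z\<in>Z. (z, y) \<notin> F}"
    have "(Z \<times> Y) \<inter> F = {}" by (auto simp: Y_def)
    moreover have Y: "Y \<subseteq> T2" "Z \<subseteq> A" "Y \<subseteq> B" using Z by (auto simp: Y_def T1_def T2_def)
    ultimately have Ym: "q * card Y < m" using F[of Z Y] True by (meson linorder_not_le)
    have "T2 - Y \<subseteq> B" by (auto simp: T2_def)
    then obtain p2 where p2: "set p2 \<subseteq> T2 - Y" "?path E2 p2" "q * card (T2 - Y) \<le> q * length p2 + d"
      using E2 unfolding path_defect_def by blast
    have "card T2 = card (T2 - Y) + card Y"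
      using Y(1) fin by (metis card_Diff_subset card_mono finite_subset le_add_diff_inverse2)
    then have "q * card T2 = q * card (T2 - Y) + q * card Y" by (simp add: distrib_left)
    with p2(3) Ym have len2: "q * card T2 \<le> q * length p2 + d + m" by linarith
    obtain z where z: "z \<in> Z" "p2 \<noteq> [] \<longrightarrow> (z, hd p2) \<in> F"
    proof (cases "p2 = []")
      case True
      have "Z \<noteq> {}" using \<open>m \<le> q * card Z\<close> \<open>m > 0\<close> by auto
      with True that show ?thesis by blast
    next
      case False
      then have "hd p2 \<in> T2 - Y" using p2(1) hd_in_set by blast
      with that show ?thesis by (auto simp: Y_def)
    qed
    obtain p1 where p1: "p1 \<noteq> []" "last p1 = z" "set p1 \<subseteq> T1" "?path E1 p1"
      "q * card T1 \<le> q * length p1 + d + m" using z(1) unfolding Z_def by blast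
    have "?path ?E (p1 @ p2)"
      using p1 p2(2) z(2) lift1 lift2 by (auto simp: successively_append_iff)
    moreover have "set (p1 @ p2) \<subseteq> T" using p1(3) p2(1) by (auto simp: T1_def T2_def)
    moreover have "q * card T \<le> q * length (p1 @ p2) + (2 * d + 2 * m)"
      using cardT p1(5) len2 by (simp add: distrib_left)
    ultimately show ?thesis by blast
  next
    case False
    have "T1 - Z \<subseteq> A" by (auto simp: T1_def)
    then obtain p1 where p1: "set p1 \<subseteq> T1 - Z" "?path E1 p1" "q * card (T1 - Z) \<le> q * length p1 + d"
      using E1 unfolding path_defect_def by blast
    have "card T1 = card (T1 - Z) + card Z"
      using Z fin by (metis card_Diff_subset card_mono le_add_diff_inverse2)
    then have "q * card T1 = q * card (T1 - Z) + q * card Z" by (simp add: distrib_left)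
    with p1(3) False have len1: "q * card T1 \<le> q * length p1 + d + m" by linarith
    \<comment> \<open>By \<open>len1\<close> the path is long enough that its last vertex would
      belong to \<open>Z\<close>, which it avoids. Hence \<open>q * card T1\<close> is at most
      \<open>d + m\<close>, and a path in \<open>T2\<close> alone suffices.\<close>
    have "p1 = []"
    proof (rule ccontr)
      assume "p1 \<noteq> []"
      moreover from this have "last p1 \<in> T1 - Z" using p1(1) last_in_set by blast
      ultimately show False using p1 len1 unfolding Z_def by blast
    qed
    have "T2 \<subseteq> B" by (auto simp: T2_def)
    then obtain p2 where p2: "set p2 \<subseteq> T2" "?path E2 p2" "q * card T2 \<le> q * length p2 + d"
      using E2 unfolding path_defect_def by blast
    have "q * card T \<le> q * length p2 + (2 * d + 2 * m)"
      using cardT p2(3) len1 \<open>p1 = []\<close> by simp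
    moreover have "set p2 \<subseteq> T" using p2(1) by (auto simp: T2_def)
    ultimately show ?thesis using lift2[OF p2(2)] by blast
  qed
qed

text \<open>Both bounds solve a doubling recurrence: the defect satisfies
  \<open>d' = 2 * d + 2 * 2 ^ h\<close>, and the edge count the same with the last term multiplied
  by \<open>q\<^sup>2\<close>. The offset \<open>a\<close> lets the induction hypothesis supply the
  shifted second copy.\<close>

lemma sparse_path_defect_exists:
  fixes a :: nat
  assumes "q > 0"
  shows "\<exists>E. E \<subseteq> {(u, v). a < u \<and> u < v \<and> v \<le> a + 2 ^ h} \<and> card E \<le> h * 2 ^ h * q\<^sup>2 \<and>
    path_defect q (h * 2 ^ h) {a<..a + 2 ^ h} E"
proof (induction h arbitrary: a)
  case 0
  have "path_defect q 0 {a<..Suc a} {}"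
    unfolding path_defect_def
  proof (intro allI impI)
    fix T assume T: "T \<subseteq> {a<..Suc a}"
    have "{a<..Suc a} = {Suc a}" by auto
    with T have "T = {} \<or> T = {Suc a}" by auto
    then show "\<exists>p. set p \<subseteq> T \<and> successively (\<lambda>u v. (u, v) \<in> {}) p \<and> q * card T \<le> q * length p + 0"
    proof
      assume "T = {Suc a}"
      then show ?thesis by (intro exI[of _ "[Suc a]"]) auto
    qed (auto intro: exI[of _ "[]"])
  qed
  then show ?case by (intro exI[of _ "{}"]) auto
next
  case (Suc h)
  let ?m = "2 ^ h :: nat"
  let ?A = "{a<..a + ?m}" and ?B = "{a + ?m<..a + ?m + ?m}"
  obtain E1 where E1: "E1 \<subseteq> {(u, v). a < u \<and> u < v \<and> v \<le> a + ?m}" "card E1 \<le> h * ?m * q\<^sup>2"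
    "path_defect q (h * ?m) ?A E1" using Suc.IH by blast
  obtain E2 where E2: "E2 \<subseteq> {(u, v). a + ?m < u \<and> u < v \<and> v \<le> a + ?m + ?m}" "card E2 \<le> h * ?m * q\<^sup>2"
    "path_defect q (h * ?m) ?B E2" using Suc.IH by blast
  obtain F where F: "F \<subseteq> ?A \<times> ?B" "card F \<le> 2 * ?m * q\<^sup>2"
    "\<And>X Y. X \<subseteq> ?A \<Longrightarrow> Y \<subseteq> ?B \<Longrightarrow> ?m \<le> q * card X \<Longrightarrow> ?m \<le> q * card Y \<Longrightarrow> (X \<times> Y) \<inter> F \<noteq> {}"
    using sparse_bipartite_expander[of ?A ?m ?B q] assms by auto
  have "path_defect q (2 * (h * ?m) + 2 * ?m) (?A \<union> ?B) (E1 \<union> E2 \<union> F)"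
    using E1(3) E2(3) F(3) by (intro path_defect_join) auto
  moreover have "?A \<union> ?B = {a<..a + 2 ^ Suc h}" by auto
  moreover have "2 * (h * ?m) + 2 * ?m = Suc h * 2 ^ Suc h" by simp
  ultimately have "path_defect q (Suc h * 2 ^ Suc h) {a<..a + 2 ^ Suc h} (E1 \<union> E2 \<union> F)" by metis
  moreover have "E1 \<union> E2 \<union> F \<subseteq> {(u, v). a < u \<and> u < v \<and> v \<le> a + 2 ^ Suc h}"
    using E1(1) E2(1) F(1) by fastforce
  moreover have "card (E1 \<union> E2 \<union> F) \<le> Suc h * 2 ^ Suc h * q\<^sup>2"
  proof -
    have "card (E1 \<union> E2 \<union> F) \<le> card E1 + card E2 + card F"
      by (meson add_le_mono card_Un_le le_refl le_trans)
    also have "\<dots> \<le> h * ?m * q\<^sup>2 + h * ?m * q\<^sup>2 + 2 * ?m * q\<^sup>2" using E1(2) E2(2) F(2) by linarith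
    also have "\<dots> = Suc h * 2 ^ Suc h * q\<^sup>2" by (simp add: algebra_simps)
    finally show ?thesis .
  qed
  ultimately show ?case by blast
qed

section \<open>Monochromatic ordered paths\<close>

lemma exists_large_color_class:
  assumes "vertex_coloring n b c" "b > 0"
  shows "\<exists>i. n \<le> b * card {v\<in>{1..n}. c v = i}"
proof (rule ccontr)
  assume neg: "\<not> ?thesis"
  have "{1..n} = (\<Union>i\<in>{1..b}. {v\<in>{1..n}. c v = i})"
    using assms(1) by (auto simp: vertex_coloring_def Pi_def)
  then have "card {1..n} \<le> (\<Sum>i\<in>{1..b}. card {v\<in>{1..n}. c v = i})"
    using card_UN_le[of "{1..b}" "\<lambda>i. {v\<in>{1..n}. c v = i}"] by (metis finite_atLeastAtMost)
  then have "b * card {1..n} \<le> (\<Sum>i\<in>{1..b}. b * card {v\<in>{1..n}. c v = i})"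
    by (simp only: mult_le_mono2 flip: sum_distrib_left)
  also have "\<dots> < (\<Sum>i\<in>{1..b}. n)" using neg \<open>b > 0\<close> by (intro sum_strict_mono) (auto simp: not_le)
  finally show False by simp
qed

lemma ordered_path_of_successively:
  assumes "length p = s + 1" "set p \<subseteq> {1..n}" "E \<subseteq> {(u, v). u < v}"
    and "successively (\<lambda>u v. (u, v) \<in> E) p"
  shows "ordered_path n ((\<lambda>(u, v). {u, v}) ` E) s p"
proof -
  have "successively (<) p" using assms(3,4) by (auto intro: successively_mono)
  then have "sorted_wrt (<) p" by (simp add: successively_conv_sorted_wrt)
  moreover have "{p ! (i - 1), p ! i} \<in> (\<lambda>(u, v). {u, v}) ` E" if "i \<in> {1..s}" for i
  proof -
    have "(p ! (i - 1), p ! Suc (i - 1)) \<in> E"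
      using assms(1) that by (intro successively_nth[OF assms(4)]) auto
    then show ?thesis using that by force
  qed
  ultimately show ?thesis using assms(1,2) by (simp add: ordered_path_def)
qed

text \<open>The bound on \<open>2 ^ h\<close> ensures that half of the guaranteed class size
  \<open>2 ^ h / b\<close> still amounts to \<open>s + 1\<close> vertices.\<close>

lemma ordered_graph_many_colors:
  fixes b s h :: nat
  assumes "b \<ge> 1" "h \<ge> 1" "2 * b * (s + 1) \<le> 2 ^ h"
  shows "\<exists>E. ordered_graph (2 ^ h) E \<and> card E \<le> 4 * b\<^sup>2 * h ^ 3 * 2 ^ h \<and>
    (\<forall>c. vertex_coloring (2 ^ h) b c \<longrightarrow> (\<exists>p. ordered_path (2 ^ h) E s p \<and> monochromatic c p))"
proof -
  let ?n = "2 ^ h :: nat"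
  \<comment> \<open>This makes the loss \<open>h * 2 ^ h / q\<close> equal to
    \<open>2 ^ h / (2 * b)\<close>, half of the guaranteed class size.\<close>
  define q where "q = 2 * b * h"
  have "q > 0" using assms by (simp add: q_def)
  obtain D where D: "D \<subseteq> {(u, v). 0 < u \<and> u < v \<and> v \<le> 0 + ?n}" "card D \<le> h * ?n * q\<^sup>2"
    "path_defect q (h * ?n) {0<..0 + ?n} D"
    using sparse_path_defect_exists[OF \<open>q > 0\<close>] by blast
  have "D \<subseteq> {1..?n} \<times> {1..?n}" using D(1) by auto
  then have finD: "finite D" by (rule finite_subset) simp
  define E where "E = (\<lambda>(u, v). {u, v}) ` D"
  have "ordered_graph ?n E" using D(1) by (fastforce simp: ordered_graph_def E_def)
  moreover have "card E \<le> 4 * b\<^sup>2 * h ^ 3 * ?n"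
  proof -
    have "card E \<le> card D" unfolding E_def using finD by (rule card_image_le)
    also have "\<dots> \<le> 4 * b\<^sup>2 * h ^ 3 * ?n"
      using D(2) by (simp add: q_def power2_eq_square power3_eq_cube algebra_simps)
    finally show ?thesis .
  qed
  moreover have "\<exists>p. ordered_path ?n E s p \<and> monochromatic c p" if c: "vertex_coloring ?n b c" for c
  proof -
    obtain i where i: "?n \<le> b * card {v\<in>{1..?n}. c v = i}"
      using exists_large_color_class[OF c] assms by auto
    define T where "T = {v\<in>{1..?n}. c v = i}"
    have "T \<subseteq> {0<..0 + ?n}" by (auto simp: T_def)
    then obtain p where p: "set p \<subseteq> T" "successively (\<lambda>u v. (u, v) \<in> D) p"
      "q * card T \<le> q * length p + h * ?n"
      using D(3) unfolding path_defect_def by blast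
    have "2 * h * ?n \<le> q * card T" using i by (simp add: q_def T_def)
    moreover have "q * length p = h * (2 * b * length p)" by (simp add: q_def)
    ultimately have "h * ?n \<le> h * (2 * b * length p)" using p(3) by linarith
    then have "?n \<le> 2 * b * length p" using assms by simp
    with assms(3) have "(2 * b) * (s + 1) \<le> (2 * b) * length p" by linarith
    then have len: "s + 1 \<le> length p" using assms(1) mult_le_cancel1[of "2 * b" "s + 1" "length p"] by linarith
    \<comment> \<open>An ordered path of length \<open>s\<close> has exactly \<open>s + 1\<close>
      vertices, so a longer path is cut to its initial segment.\<close>
    define p' where "p' = take (s + 1) p"
    have "set p' \<subseteq> T" using p(1) set_take_subset[of "s + 1" p] by (auto simp: p'_def)
    moreover have "length p' = s + 1" using len by (simp add: p'_def)
    moreover have "successively (\<lambda>u v. (u, v) \<in> D) p'"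
      using p(2) by (simp add: p'_def successively_conv_nth)
    ultimately have p': "length p' = s + 1" "set p' \<subseteq> T" "successively (\<lambda>u v. (u, v) \<in> D) p'"
      by blast+
    have "ordered_path ?n E s p'" unfolding E_def
      using p' D(1) by (intro ordered_path_of_successively) (auto simp: T_def)
    moreover have "monochromatic c p'" using p'(2) by (auto simp: monochromatic_def T_def)
    ultimately show ?thesis by blast
  qed
  ultimately show ?thesis by blast
qed

text \<open>For \<open>b = 1\<close> the exponent in the theorem vanishes and only \<open>s\<close>
  edges are allowed, which the general construction's bound exceeds. The bare path on
  \<open>s + 1\<close> vertices meets it exactly.\<close>

lemma ordered_graph_one_color:
  "\<exists>E. ordered_graph (s + 1) E \<and> card E \<le> s \<and>
    (\<forall>c. vertex_coloring (s + 1) 1 c \<longrightarrow> (\<exists>p. ordered_path (s + 1) E s p \<and> monochromatic c p))"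
proof -
  let ?E = "(\<lambda>(u, v). {u, v}) ` (\<lambda>i. (i, Suc i)) ` {1..s}"
  have "ordered_graph (s + 1) ?E" by (auto simp: ordered_graph_def)
  moreover have "card ?E \<le> s" by (simp add: image_image le_trans[OF card_image_le])
  moreover have "ordered_path (s + 1) ?E s [1..<s + 2]"
    by (intro ordered_path_of_successively) (auto simp: successively_conv_nth simp del: upt_Suc)
  moreover have "monochromatic c [1..<s + 2]" if "vertex_coloring (s + 1) 1 c" for c
    using that by (auto simp: monochromatic_def vertex_coloring_def Pi_def)
  ultimately show ?thesis by blast
qed

section \<open>Edge count and conclusion\<close>

text \<open>With \<open>b\<close> and \<open>s\<close> at least 2, both \<open>ln b\<close> and
  \<open>sqrt (ln s)\<close> are at least \<open>1 / 2\<close>, so constants and the factors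
  polynomial in \<open>b\<close> and \<open>ln s\<close> can be absorbed into the product in the
  exponent.\<close>

lemma edge_count_estimate:
  fixes b s h :: nat
  assumes b: "b \<ge> 2" and s: "s \<ge> 2" and h: "2 ^ h \<le> 4 * b * (s + 1)"
  shows "real (4 * b\<^sup>2 * h ^ 3 * 2 ^ h) \<le> real s * exp (76 * ln (real b) * sqrt (ln (real s)))"
proof -
  define B where "B = ln (real b)"
  define L where "L = sqrt (ln (real s))"
  have ln2: "1 / 2 \<le> ln (2::real)" "ln (2::real) \<le> 1"
    using ln_le_minus_one[of "1 / 2 :: real"] ln_le_minus_one[of "2::real"] by (auto simp: ln_div)
  have "ln 2 \<le> ln (real b)" "ln 2 \<le> ln (real s)" using b s by auto
  then have B: "1 / 2 \<le> B" and lns: "1 / 2 \<le> ln (real s)" using ln2 by (auto simp: B_def)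
  have L2: "L\<^sup>2 = ln (real s)" using lns by (simp add: L_def)
  have L: "1 / 2 \<le> L" unfolding L_def using lns by (intro real_le_rsqrt) (simp add: power2_eq_square)
  \<comment> \<open>\<open>4 * (s + 1) \<le> 6 * s\<close> holds from \<open>s = 2\<close>
    on.\<close>
  have "4 * b * (s + 1) \<le> 6 * b * s" using s b by (simp add: algebra_simps)
  with h have "2 ^ h \<le> 6 * b * s" by linarith
  then have n: "(2::real) ^ h \<le> 6 * real b * real s"
    by (metis (no_types, lifting) of_nat_le_iff of_nat_mult of_nat_numeral of_nat_power)
  have "real h * ln 2 = ln (2 ^ h)" by (simp add: ln_realpow)
  also have "\<dots> \<le> ln (6 * real b * real s)" using n by (intro ln_mono) auto
  also have "\<dots> = ln 6 + B + L\<^sup>2" using b s by (simp add: ln_mult B_def L2)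
  also have "\<dots> \<le> 3 + B + L\<^sup>2"
  proof -
    have "ln (6::real) \<le> ln (2 ^ 3)" by (intro ln_mono) auto
    also have "\<dots> = 3 * ln 2" by (subst ln_realpow) auto
    also have "\<dots> \<le> 3" using ln2 by simp
    finally show ?thesis by simp
  qed
  finally have "real h * (1 / 2) \<le> 3 + B + L\<^sup>2"
    using mult_left_mono[OF ln2(1), of "real h"] by linarith
  moreover have "(1 + B) * (1 + L)\<^sup>2 = 1 + B + L\<^sup>2 + (2 * L + 2 * L * B + L\<^sup>2 * B)"
    by (simp add: power2_eq_square algebra_simps)
  moreover have "0 \<le> 2 * L + 2 * L * B + L\<^sup>2 * B" "0 \<le> L\<^sup>2" using B L by auto
  ultimately have "real h \<le> 6 * ((1 + B) * (1 + L)\<^sup>2)" using B by linarith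
  \<comment> \<open>Applying \<open>1 + x \<le> exp x\<close> to \<open>L\<close> rather than to
    \<open>ln s\<close> makes powers of \<open>ln s\<close> cost only a multiple of \<open>L\<close>
    in the exponent.\<close>
  also have "\<dots> \<le> 6 * (exp B * (exp L)\<^sup>2)"
    using B L by (intro mult_left_mono mult_mono power_mono exp_ge_add_one_self) auto
  finally have "real h ^ 3 \<le> (6 * (exp B * (exp L)\<^sup>2)) ^ 3" by (intro power_mono) auto
  also have "\<dots> = 216 * (exp (3 * B) * exp (6 * L))"
    by (simp add: power_mult_distrib power_divide flip: exp_of_nat_mult)
  finally have h3: "real h ^ 3 \<le> 216 * (exp (3 * B) * exp (6 * L))" .
  have expB: "exp B = real b" using b by (simp add: B_def)
  have "real (4 * b\<^sup>2 * h ^ 3 * 2 ^ h) = 4 * (exp B)\<^sup>2 * real h ^ 3 * 2 ^ h" by (simp add: expB)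
  also have "\<dots> \<le> 4 * (exp B)\<^sup>2 * (216 * (exp (3 * B) * exp (6 * L))) * (6 * exp B * real s)"
    using h3 n by (intro mult_mono) (auto simp: expB)
  \<comment> \<open>\<open>5184 = 4 * 216 * 6\<close>, and the powers of \<open>exp B\<close> add up
    to \<open>2 + 3 + 1\<close>.\<close>
  also have "\<dots> = 5184 * real s * exp (6 * B + 6 * L)"
    by (simp add: power2_eq_square algebra_simps flip: exp_add)
  also have "\<dots> \<le> exp 13 * real s * exp (6 * B + 6 * L)"
  proof -
    have "(5184::real) \<le> 2 ^ 13" by simp
    also have "\<dots> \<le> exp 1 ^ 13" using exp_ge_add_one_self[of "1::real"] by (intro power_mono) auto
    also have "\<dots> = exp 13" by (simp flip: exp_of_nat_mult)
    finally show ?thesis by (intro mult_right_mono) auto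
  qed
  also have "\<dots> = real s * exp (13 + 6 * B + 6 * L)" by (simp add: exp_add)
  also have "\<dots> \<le> real s * exp (76 * B * L)"
  proof -
    have "1 / 2 * L \<le> B * L" "B * (1 / 2) \<le> B * L"
      using B L by (intro mult_right_mono mult_left_mono; simp)+
    \<comment> \<open>Since \<open>B\<close> and \<open>L\<close> are at least \<open>1 / 2\<close>,
      the three terms are at most 52, 12 and 12 times \<open>B * L\<close>, which is the origin of
      76.\<close>
    then have "13 + 6 * B + 6 * L \<le> 76 * B * L" using L by linarith
    then show ?thesis by (intro mult_left_mono) auto
  qed
  finally show ?thesis by (simp add: B_def L_def)
qed

theorem theorem1p2:
  shows "\<exists>C::real. C > 0 \<and>
    (\<forall>(b::nat) (s::nat). b \<ge> 1 \<and> s \<ge> 2 \<longrightarrow>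
      (\<exists>(n::nat) (E::nat set set). ordered_graph n E \<and>
         real (card E) \<le> real s * exp (C * ln (real b) * sqrt (ln (real s))) \<and>
         (\<forall>c. vertex_coloring n b c \<longrightarrow>
            (\<exists>p. ordered_path n E s p \<and> monochromatic c p))))"
proof (rule exI[of _ 76], intro conjI allI impI)
  fix b s :: nat
  assume bs: "b \<ge> 1 \<and> s \<ge> 2"
  show "\<exists>n E. ordered_graph n E \<and> real (card E) \<le> real s * exp (76 * ln (real b) * sqrt (ln (real s))) \<and>
    (\<forall>c. vertex_coloring n b c \<longrightarrow> (\<exists>p. ordered_path n E s p \<and> monochromatic c p))"
  proof (cases "b = 1")
    case True
    obtain E where "ordered_graph (s + 1) E" "card E \<le> s"
      "\<forall>c. vertex_coloring (s + 1) 1 c \<longrightarrow> (\<exists>p. ordered_path (s + 1) E s p \<and> monochromatic c p)"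
      using ordered_graph_one_color by blast
    with True show ?thesis by (intro exI[of _ "s + 1"] exI[of _ E]) auto
  next
    case False
    \<comment> \<open>Minimality keeps \<open>2 ^ h\<close> within a factor 2 of the required size,
      giving the upper bound that the edge estimate needs.\<close>
    define h where "h = (LEAST h. 2 * b * (s + 1) \<le> 2 ^ h)"
    have ge: "2 * b * (s + 1) \<le> 2 ^ h"
      unfolding h_def by (rule LeastI[of _ "2 * b * (s + 1)"]) (simp add: less_imp_le)
    have "h \<noteq> 0" using ge bs by (cases h) auto
    then obtain k where k: "h = Suc k" by (cases h) auto
    have "\<not> 2 * b * (s + 1) \<le> 2 ^ k" using not_less_Least[of k "\<lambda>h. 2 * b * (s + 1) \<le> 2 ^ h"] k
      unfolding h_def by simp
    then have le: "2 ^ h \<le> 4 * b * (s + 1)" using k by simp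
    obtain E where "ordered_graph (2 ^ h) E" "card E \<le> 4 * b\<^sup>2 * h ^ 3 * 2 ^ h"
      "\<forall>c. vertex_coloring (2 ^ h) b c \<longrightarrow> (\<exists>p. ordered_path (2 ^ h) E s p \<and> monochromatic c p)"
      using ordered_graph_many_colors[OF _ _ ge] bs k by auto
    moreover from this have "real (card E) \<le> real s * exp (76 * ln (real b) * sqrt (ln (real s)))"
      using edge_count_estimate[OF _ _ le] bs False
      by (smt (verit, best) of_nat_mono One_nat_def Suc_1 le_neq_implies_less less_eq_Suc_le)
    ultimately show ?thesis by blast
  qed
qed simp_all

end
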